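(* Consider a new seller in the E-commerce reputation model described in the context, who advertises honestly. Let $T_r = d\cdot\min\{\tau\in\{0,1,2,\ldots\} : r(\tau)\ge r_h\}$ be the ramp up time, let $T_w>0$ with $T_w/d\in\mathbb{N}$ be the maximum time the seller is willing to wait, and let $P_d=\Pr[T_r>T_w]$ be the new seller drop out probability. Then $$P_d=\sum_{k=0}^{r_h-1} e^{-\lambda_1P_{ba}T_w}\,\frac{(\lambda_1P_{ba}T_w)^k}{k!}.$$ Moreover, $P_d$ decreases in $\lambda_1P_{ba}$, decreases in $T_w$, and increases in $r_h$ (in each case with the other parameters fixed).
   Context: Time is divided into slots; slot $\tau\in\{0,1,2,\ldots\}$ is the interval $[\tau d,(\tau+1)d)$, where $d>0$ is the shipment delay. A seller has an integer reputation score $r(\tau)$ in slot $\tau$, with $r(0)=0$. Let $N(\tau)$ be the number of products sold (transactions) in slot $\tau$. The seller is honest (advertised quality equals intrinsic quality $Q_i$), so every transaction yields a positive feedback $+1$, and $r(\tau+1)=r(\tau)+N(\tau)$. The reputation threshold $r_h\ge 1$ is an integer. A seller is labeled reputable if $r\ge r_h$ and the fraction of positive feedbacks is at least a given $\theta\in(0,1]$ (this second condition is automatic for an honest seller), and is labeled average otherwise. Buyers arrive at the seller's store according to a Poisson process with rate $\lambda_1>0$ during slots $\tau$ with $r(\tau)<r_h$ and with rate $\lambda_2>\lambda_1$ during slots $\tau$ with $r(\tau)\ge r_h$. Each arriving buyer independently buys one product, with probability $P_{ba}=\mathcal{P}(\beta Q_i,p)$ if the seller is labeled average and $P_{br}=\mathcal{P}(Q_i,p)$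 if the seller is labeled reputable. Here $\mathcal{P}(Q,p)\in[0,1]$ is increasing in the quality $Q$ and decreasing in the price $p$, $\beta\in[0,1]$ is a discounting factor, and $P_{ba}>0$. Hence, given the history up to time $\tau d$, $N(\tau)$ is Poisson distributed with parameter $\lambda_1P_{ba}d$ if $r(\tau)<r_h$ and $\lambda_2P_{br}d$ if $r(\tau)\ge r_h$. *)

theory Defs
  imports "HOL-Probability.Probability"
begin

text \<open>
  One record carries both the parameters of the model and its random objects. For a real time
  \<open>t \<ge> 0\<close>, \<open>arrivals S t\<close> is the number of buyers who arrive during \<open>[0, t)\<close> and \<open>history S t\<close> is
  the sigma-algebra of the history up to time \<open>t\<close>. Buyers are numbered \<open>0, 1, 2, \<dots>\<close> in their order
  of arrival; \<open>buys S j\<close> is the decision of buyer \<open>j\<close> and \<open>feedback S j\<close> is the feedback that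
  buyer \<open>j\<close> leaves if he or she buys.
\<close>

record 'a seller_model =
  delay :: real
  arrival_rate_avg :: real
  arrival_rate_rep :: real
  purchase_prob :: "real \<Rightarrow> real \<Rightarrow> real"
  discount :: real
  intrinsic_quality :: real
  advertised_quality :: real
  price :: real
  rep_threshold :: nat
  pos_fraction :: real
  prob_meas :: "'a measure"
  history :: "real \<Rightarrow> 'a measure"
  arrivals :: "real \<Rightarrow> 'a \<Rightarrow> nat"
  buys :: "nat \<Rightarrow> 'a \<Rightarrow> bool"
  feedback :: "nat \<Rightarrow> 'a \<Rightarrow> int"

definition P_ba :: "'a seller_model \<Rightarrow> real" where
  "P_ba S = purchase_prob S (discount S * intrinsic_quality S) (price S)"

definition P_br :: "'a seller_model \<Rightarrow> real" where
  "P_br S = purchase_prob S (intrinsic_quality S) (price S)"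

definition slot_start :: "'a seller_model \<Rightarrow> nat \<Rightarrow> real" where
  "slot_start S \<tau> = real \<tau> * delay S"

text \<open>The purchase decisions, in order of arrival, of the buyers arriving in slot \<open>\<tau>\<close>.\<close>

definition decisions :: "'a seller_model \<Rightarrow> nat \<Rightarrow> 'a \<Rightarrow> bool list" where
  "decisions S \<tau> \<omega> =
     map (\<lambda>j. buys S j \<omega>)
       [arrivals S (slot_start S \<tau>) \<omega> ..< arrivals S (slot_start S (Suc \<tau>)) \<omega>]"

definition transactions :: "'a seller_model \<Rightarrow> nat \<Rightarrow> 'a \<Rightarrow> nat set" where
  "transactions S \<tau> \<omega> = {j. j < arrivals S (slot_start S \<tau>) \<omega> \<and> buys S j \<omega>}"

definition reputation :: "'a seller_model \<Rightarrow> nat \<Rightarrow> 'a \<Rightarrow> int" where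
  "reputation S \<tau> \<omega> = (\<Sum>j\<in>transactions S \<tau> \<omega>. feedback S j \<omega>)"

definition reputable :: "'a seller_model \<Rightarrow> nat \<Rightarrow> 'a \<Rightarrow> bool" where
  "reputable S \<tau> \<omega> \<longleftrightarrow>
     reputation S \<tau> \<omega> \<ge> int (rep_threshold S) \<and>
     real (card {j \<in> transactions S \<tau> \<omega>. feedback S j \<omega> = 1}) / real (card (transactions S \<tau> \<omega>))
       \<ge> pos_fraction S"

definition slot_arrival_rate :: "'a seller_model \<Rightarrow> nat \<Rightarrow> 'a \<Rightarrow> real" where
  "slot_arrival_rate S \<tau> \<omega> =
     (if reputation S \<tau> \<omega> < int (rep_threshold S) then arrival_rate_avg S else arrival_rate_rep S)"

definition slot_purchase_prob :: "'a seller_model \<Rightarrow> nat \<Rightarrow> 'a \<Rightarrow> real" where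
  "slot_purchase_prob S \<tau> \<omega> = (if reputable S \<tau> \<omega> then P_br S else P_ba S)"

text \<open>
  The history before slot \<open>\<tau>\<close> together with the whole arrival process of slot \<open>\<tau>\<close> (but not the
  decisions of the buyers arriving in that slot).
\<close>

definition history_and_arrivals :: "'a seller_model \<Rightarrow> nat \<Rightarrow> 'a measure" where
  "history_and_arrivals S \<tau> =
     sigma (space (prob_meas S))
       (sets (history S (slot_start S \<tau>)) \<union>
        {{\<omega> \<in> space (prob_meas S). arrivals S t \<omega> = n} | t n.
           t \<in> {slot_start S \<tau> .. slot_start S (Suc \<tau>)}})"

text \<open>\<open>K\<close> is a regular conditional distribution, given \<open>G\<close>, of the discrete random variable \<open>X\<close>.\<close>

definition has_cond_pmf ::
  "'a measure \<Rightarrow> 'a measure \<Rightarrow> ('a \<Rightarrow> 'b::countable) \<Rightarrow> ('a \<Rightarrow> 'b pmf) \<Rightarrow> bool" where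
  "has_cond_pmf M G X K \<longleftrightarrow>
     X \<in> measurable M (count_space UNIV) \<and>
     (\<forall>x. (\<lambda>\<omega>. pmf (K \<omega>) x) \<in> borel_measurable G) \<and>
     (\<forall>H\<in>sets G. \<forall>x. measure M {\<omega>\<in>H. X \<omega> = x} = (LINT \<omega>:H|M. pmf (K \<omega>) x))"

text \<open>
  A new seller who advertises honestly. \<open>arrivals_poisson\<close> says that during slot \<open>\<tau>\<close> buyers arrive
  according to a Poisson process whose rate is determined by the reputation at the start of
  the slot: increments over \<open>[s, t)\<close> are Poisson given the history up to \<open>s\<close>. \<open>decisions_iid\<close> says
  that, given the history and the arrivals of the slot, the arriving buyers decide independently
  with the probability determined by the label of the seller.
\<close>

locale honest_seller =
  prob_space "prob_meas S" + filtration "space (prob_meas S)" "history S"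
  for S :: "'a seller_model" +
  assumes delay_pos: "delay S > 0"
    and rates: "0 < arrival_rate_avg S" "arrival_rate_avg S < arrival_rate_rep S"
    and purchase_prob_range: "\<And>Q p. purchase_prob S Q p \<in> {0..1}"
    and purchase_prob_quality: "\<And>p. mono (\<lambda>Q. purchase_prob S Q p)"
    and purchase_prob_price: "\<And>Q. antimono (\<lambda>p. purchase_prob S Q p)"
    and discount_range: "discount S \<in> {0..1}"
    and P_ba_pos: "P_ba S > 0"
    and rep_threshold_pos: "rep_threshold S \<ge> 1"
    and pos_fraction_range: "pos_fraction S \<in> {0<..1}"
    and history_sub: "\<And>t. subalgebra (prob_meas S) (history S t)"
    and arrivals_0: "\<And>\<omega>. \<omega> \<in> space (prob_meas S) \<Longrightarrow> arrivals S 0 \<omega> = 0"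
    and arrivals_mono:
      "\<And>\<omega> s t. \<omega> \<in> space (prob_meas S) \<Longrightarrow> 0 \<le> s \<Longrightarrow> s \<le> t \<Longrightarrow> arrivals S s \<omega> \<le> arrivals S t \<omega>"
    and arrivals_adapted:
      "\<And>t. t \<ge> 0 \<Longrightarrow> arrivals S t \<in> measurable (history S t) (count_space UNIV)"
    and buys_adapted:
      "\<And>t j. t \<ge> 0 \<Longrightarrow>
         {\<omega> \<in> space (prob_meas S). j < arrivals S t \<omega> \<and> buys S j \<omega>} \<in> sets (history S t)"
    and arrivals_poisson:
      "\<And>\<tau> s t. slot_start S \<tau> \<le> s \<Longrightarrow> s < t \<Longrightarrow> t \<le> slot_start S (Suc \<tau>) \<Longrightarrow>
         has_cond_pmf (prob_meas S) (history S s)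
           (\<lambda>\<omega>. arrivals S t \<omega> - arrivals S s \<omega>)
           (\<lambda>\<omega>. poisson_pmf (slot_arrival_rate S \<tau> \<omega> * (t - s)))"
    and decisions_iid:
      "\<And>\<tau>. has_cond_pmf (prob_meas S) (history_and_arrivals S \<tau>) (decisions S \<tau>)
         (\<lambda>\<omega>. replicate_pmf
            (arrivals S (slot_start S (Suc \<tau>)) \<omega> - arrivals S (slot_start S \<tau>) \<omega>)
            (bernoulli_pmf (slot_purchase_prob S \<tau> \<omega>)))"
    and honest: "advertised_quality S = intrinsic_quality S"
    and honest_feedback:
      "\<And>\<omega> j. \<omega> \<in> space (prob_meas S) \<Longrightarrow> advertised_quality S = intrinsic_quality S \<Longrightarrow>
         buys S j \<omega> \<Longrightarrow> feedback S j \<omega> = 1"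

definition ramp_up_time :: "'a seller_model \<Rightarrow> 'a \<Rightarrow> ereal" where
  "ramp_up_time S \<omega> =
     (if \<exists>\<tau>. reputation S \<tau> \<omega> \<ge> int (rep_threshold S)
      then ereal (delay S * real (LEAST \<tau>. reputation S \<tau> \<omega> \<ge> int (rep_threshold S)))
      else \<infinity>)"

definition drop_out_prob :: "'a seller_model \<Rightarrow> real \<Rightarrow> real" where
  "drop_out_prob S T\<^sub>w =
     measure (prob_meas S) {\<omega> \<in> space (prob_meas S). ramp_up_time S \<omega> > ereal T\<^sub>w}"

end

theory Submission
  imports Defs
begin

text \<open>
  While the seller is still average, the sales of a slot are a Poisson number of arrivals thinned by
  independent coin flips, hence Poisson with parameter \<open>\<lambda>\<^sub>1 P\<^sub>b\<^sub>a d\<close>. To end slot \<open>\<tau>\<close> with a score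
  \<open>k < r\<^sub>h\<close> the seller must have been average throughout, so by convolution the law of the score on
  \<open>{0, \<dots>, r\<^sub>h - 1}\<close> is that of a Poisson variable with parameter \<open>\<lambda>\<^sub>1 P\<^sub>b\<^sub>a \<tau> d\<close>, whatever happens above the
  threshold. The score is nondecreasing, so the seller drops out iff it is below \<open>r\<^sub>h\<close> at time \<open>T\<^sub>w\<close>.
  Monotonicity follows as the Poisson distribution function at \<open>n\<close> has the derivative
  \<open>- exp (- x) x\<^sup>n / n!\<close> in the parameter \<open>x\<close>.
\<close>

section \<open>Conditional laws with a constant kernel\<close>

lemma has_cond_pmf_measurable: "has_cond_pmf M G X K \<Longrightarrow> X \<in> measurable M (count_space UNIV)"
  by (simp add: has_cond_pmf_def)

text \<open>On \<open>H\<close> the integral of the kernel collapses to a product, and summing over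
  the countably many values passes from points to \<open>B\<close>. This turns the modelling
  assumptions into product formulas: their kernels depend on the outcome only through the seller's
  rate or label and the number of arrivals, which suitable events \<open>H\<close> fix.\<close>

lemma has_cond_pmf_const_emeasure:
  assumes "finite_measure M" and G: "subalgebra M G" and X: "has_cond_pmf M G X K"
    and H: "H \<in> sets G" and K: "\<And>\<omega>. \<omega> \<in> H \<Longrightarrow> K \<omega> = q"
  shows "emeasure M {\<omega>\<in>H. X \<omega> \<in> B} = emeasure M H * emeasure (measure_pmf q) B"
proof -
  interpret finite_measure M by fact
  have HM: "H \<in> sets M" using G H by (auto simp: subalgebra_def)
  note [measurable] = HM has_cond_pmf_measurable[OF X]
  have Hsp: "H \<subseteq> space M" using HM by (rule sets.sets_into_space)
  have eq: "{\<omega>\<in>H. X \<omega> \<in> C} = {\<omega>\<in>space M. \<omega> \<in> H \<and> X \<omega> \<in> C}" for C using Hsp by auto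
  have meas: "{\<omega>\<in>H. X \<omega> = x} \<in> sets M" for x
    unfolding eq[of "{x}", simplified] by measurable
  have single: "emeasure M {\<omega>\<in>H. X \<omega> = x} = emeasure M H * ennreal (pmf q x)" for x
  proof -
    have "measure M {\<omega>\<in>H. X \<omega> = x} = (LINT \<omega>:H|M. pmf (K \<omega>) x)"
      using X H by (auto simp: has_cond_pmf_def)
    also have "\<dots> = (LINT \<omega>:H|M. pmf q x)"
      using HM K by (intro set_lebesgue_integral_cong) auto
    also have "\<dots> = measure M H * pmf q x"
      using HM by (simp add: set_integral_const emeasure_eq_measure)
    finally show ?thesis by (simp add: emeasure_eq_measure ennreal_mult)
  qed
  have "emeasure M {\<omega>\<in>H. X \<omega> \<in> B} = emeasure M (\<Union>x\<in>B. {\<omega>\<in>H. X \<omega> = x})"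
    by (rule arg_cong[where f = "emeasure M"]) auto
  also have "\<dots> = (\<integral>\<^sup>+x. emeasure M {\<omega>\<in>H. X \<omega> = x} \<partial>count_space B)"
    using meas by (intro emeasure_UN_countable) (auto simp: disjoint_family_on_def)
  also have "\<dots> = emeasure M H * emeasure (measure_pmf q) B"
    by (simp add: single nn_integral_cmult nn_integral_pmf)
  finally show ?thesis .
qed

section \<open>Poisson distributions: thinning, convolution and distribution function\<close>

text \<open>With \<open>n = i + m\<close>, writing the binomial coefficient by factorials cancels
  \<open>fact n\<close>; what remains of the sum over \<open>n\<close> is the exponential series at
  \<open>r * (1 - p)\<close>.\<close>

lemma poisson_pmf_thinning:
  assumes "0 < r" "0 < p" "p \<le> 1"
  shows "bind_pmf (poisson_pmf r) (\<lambda>n. binomial_pmf n p) = poisson_pmf (r * p)"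
proof (rule pmf_eqI)
  fix m :: nat
  define f where "f n = pmf (poisson_pmf r) n * pmf (binomial_pmf n p) m" for n
  have f_shift: "f (i + m) = ((r * p) ^ m / fact m * exp (- r)) * ((r * (1 - p)) ^ i /\<^sub>R fact i)" for i
    using assms binomial_fact[of m "i + m", where 'a = real]
    by (simp add: f_def power_add divide_simps)
  have f_0: "f n = 0" if "n < m" for n
    using that assms by (simp add: f_def)
  have "(\<lambda>i. f (i + m)) sums ((r * p) ^ m / fact m * exp (- r) * exp (r * (1 - p)))"
    unfolding f_shift by (intro sums_mult exp_converges)
  also have "exp (- r) * exp (r * (1 - p)) = exp (- (r * p))"
    by (simp add: mult_exp_exp algebra_simps)
  hence "(r * p) ^ m / fact m * exp (- r) * exp (r * (1 - p)) = pmf (poisson_pmf (r * p)) m"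
    using assms by (simp add: mult.assoc)
  finally have f_sums: "f sums pmf (poisson_pmf (r * p)) m"
    using sums_zero_iff_shift[of m f] f_0 by simp
  have "ennreal (pmf (bind_pmf (poisson_pmf r) (\<lambda>n. binomial_pmf n p)) m) = (\<Sum>n. ennreal (f n))"
    by (simp add: ennreal_pmf_bind nn_integral_measure_pmf nn_integral_count_space_nat f_def
        ennreal_mult del: pmf_poisson pmf_binomial)
  also have "\<dots> = ennreal (pmf (poisson_pmf (r * p)) m)"
    using f_sums by (subst suminf_ennreal2) (auto simp: f_def sums_iff simp del: pmf_poisson pmf_binomial)
  finally show "pmf (bind_pmf (poisson_pmf r) (\<lambda>n. binomial_pmf n p)) m = pmf (poisson_pmf (r * p)) m"
    by (simp del: pmf_poisson)
qed

text \<open>A real function rather than \<open>poisson_pmf\<close>, which is unspecified at rate \<open>0\<close>.\<close>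

definition poisson_density :: "real \<Rightarrow> nat \<Rightarrow> real" where
  "poisson_density x k = exp (- x) * (x ^ k / fact k)"

lemma poisson_density_pos: "x > 0 \<Longrightarrow> poisson_density x k > 0"
  by (simp add: poisson_density_def)

lemma pmf_poisson_density: "x > 0 \<Longrightarrow> pmf (poisson_pmf x) k = poisson_density x k"
  by (simp add: poisson_density_def)

text \<open>After multiplying and dividing by \<open>fact k\<close>, this is the binomial theorem
  for \<open>(x + y) ^ k\<close>. The case \<open>x = 0\<close> serves the first slot in the
  induction over slots.\<close>

lemma poisson_density_convolution:
  "(\<Sum>j\<le>k. poisson_density x j * poisson_density y (k - j)) = poisson_density (x + y) k"
proof -
  have "(\<Sum>j\<le>k. poisson_density x j * poisson_density y (k - j)) =
      (\<Sum>j\<le>k. exp (- (x + y)) / fact k * (real (k choose j) * x ^ j * y ^ (k - j)))"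
    by (intro sum.cong refl) (simp add: poisson_density_def binomial_fact exp_diff exp_minus field_simps exp_add)
  also have "\<dots> = poisson_density (x + y) k"
    unfolding poisson_density_def binomial_ring sum_distrib_left[symmetric] by simp
  finally show ?thesis .
qed

text \<open>The derivative of term \<open>k\<close> is term \<open>k - 1\<close> minus term
  \<open>k\<close> (for \<open>k = 0\<close> just minus the term itself), so the sum telescopes to
  its last term; \<open>Suc n\<close> ensures that there is one.\<close>

lemma poisson_cdf_has_derivative:
  "((\<lambda>x. \<Sum>k<Suc n. poisson_density x k) has_real_derivative - poisson_density x n) (at x)"
proof (induction n)
  case 0
  show ?case by (auto simp: poisson_density_def intro!: derivative_eq_intros)
next
  case (Suc n)
  have "((\<lambda>x. poisson_density x (Suc n)) has_real_derivative
      poisson_density x n - poisson_density x (Suc n)) (at x)"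
    unfolding poisson_density_def
    by (rule derivative_eq_intros refl | simp)+
  from DERIV_add[OF Suc.IH this] show ?case by (simp add: add.commute)
qed

lemma poisson_cdf_strict_decreasing:
  assumes "0 < n" "0 \<le> x" "x < y"
  shows "(\<Sum>k<n. poisson_density y k) < (\<Sum>k<n. poisson_density x k)"
proof -
  obtain m where n: "n = Suc m" using \<open>0 < n\<close> by (cases n) auto
  show ?thesis unfolding n
  \<comment> \<open>For \<open>x = 0\<close> the derivative vanishes at the left endpoint as soon as
    \<open>m > 0\<close>, so its sign is used in the open interval only, with continuity covering
    the endpoints.\<close>
  proof (rule DERIV_neg_imp_decreasing_open[OF \<open>x < y\<close>])
    fix z assume "x < z" "z < y"
    thus "\<exists>D. ((\<lambda>x. \<Sum>k<Suc m. poisson_density x k) has_real_derivative D) (at z) \<and> D < 0"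
      using poisson_cdf_has_derivative[of m z] poisson_density_pos[of z m] \<open>0 \<le> x\<close>
      by (intro exI[of _ "- poisson_density z m"]) auto
  next
    show "continuous_on {x..y} (\<lambda>x. \<Sum>k<Suc m. poisson_density x k)"
      by (intro DERIV_continuous_on[OF has_field_derivative_at_within[OF poisson_cdf_has_derivative]])
  qed
qed

section \<open>The score as a count of transactions, and the ramp up time\<close>

context honest_seller
begin

lemma finite_transactions: "finite (transactions S \<tau> \<omega>)"
  by (simp add: transactions_def)

text \<open>By honesty every buyer's feedback is +1. This allows the score to be treated as a
  natural number from here on.\<close>

lemma reputation_eq_card:
  assumes "\<omega> \<in> space (prob_meas S)"
  shows "reputation S \<tau> \<omega> = int (card (transactions S \<tau> \<omega>))"
  using assms honest honest_feedback by (simp add: reputation_def transactions_def)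

lemma slot_start_nonneg: "0 \<le> slot_start S \<tau>"
  using delay_pos by (simp add: slot_start_def)

lemma slot_start_mono: "\<sigma> \<le> \<tau> \<Longrightarrow> slot_start S \<sigma> \<le> slot_start S \<tau>"
  using delay_pos by (simp add: slot_start_def)

lemma slot_start_less: "slot_start S \<tau> < slot_start S (Suc \<tau>)"
  using delay_pos by (simp add: slot_start_def)

lemma transactions_mono:
  assumes "\<omega> \<in> space (prob_meas S)" "\<sigma> \<le> \<tau>"
  shows "transactions S \<sigma> \<omega> \<subseteq> transactions S \<tau> \<omega>"
  using arrivals_mono[OF assms(1) slot_start_nonneg slot_start_mono[OF assms(2)]]
  by (auto simp: transactions_def)

lemma card_transactions_mono:
  "\<omega> \<in> space (prob_meas S) \<Longrightarrow> \<sigma> \<le> \<tau> \<Longrightarrow> card (transactions S \<sigma> \<omega>) \<le> card (transactions S \<tau> \<omega>)"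
  by (intro card_mono finite_transactions transactions_mono)

lemma ramp_up_time_gr_iff:
  assumes \<omega>: "\<omega> \<in> space (prob_meas S)"
  shows "ramp_up_time S \<omega> > ereal (real n * delay S) \<longleftrightarrow> card (transactions S n \<omega>) < rep_threshold S"
proof (cases "\<exists>\<tau>. rep_threshold S \<le> card (transactions S \<tau> \<omega>)")
  case True
  define L where "L = (LEAST \<tau>. rep_threshold S \<le> card (transactions S \<tau> \<omega>))"
  have "rep_threshold S \<le> card (transactions S L \<omega>)"
    unfolding L_def using True by (rule LeastI_ex)
  moreover have "L \<le> n" if "rep_threshold S \<le> card (transactions S n \<omega>)"
    unfolding L_def using that by (rule Least_le)
  \<comment> \<open>Minimality of \<open>L\<close> gives one direction; for the other, if
    \<open>L \<le> n\<close> then monotonicity carries the score reached at \<open>L\<close> over to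
    \<open>n\<close>.\<close>
  ultimately have "n < L \<longleftrightarrow> card (transactions S n \<omega>) < rep_threshold S"
    using card_transactions_mono[OF \<omega>, of L n] by (meson not_less order.trans)
  moreover have "ramp_up_time S \<omega> = ereal (delay S * real L)"
    using True by (simp add: ramp_up_time_def reputation_eq_card[OF \<omega>] L_def)
  ultimately show ?thesis using delay_pos by (simp add: mult.commute)
next
  case False
  \<comment> \<open>The threshold is never reached, so both sides hold, the left one because the
    ramp up time is then \<infinity>.\<close>
  hence below: "\<not> rep_threshold S \<le> card (transactions S \<tau> \<omega>)" for \<tau> by blast
  thus ?thesis
    by (simp add: ramp_up_time_def reputation_eq_card[OF \<omega>] below not_le[THEN iffD1, OF below])
qed

lemma drop_out_prob_eq_reputation:
  "drop_out_prob S (real n * delay S) =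
     prob {\<omega> \<in> space (prob_meas S). card (transactions S n \<omega>) < rep_threshold S}"
  unfolding drop_out_prob_def using ramp_up_time_gr_iff
  by (intro arg_cong[where f = prob]) auto

lemma space_history: "space (history S t) = space (prob_meas S)"
  using history_sub[of t] by (simp add: subalgebra_def)

section \<open>Measurability of the score\<close>

text \<open>The filtration is only assumed to see the arrival count and the single purchases, so the
  cardinality is written as a sum of purchase indicators up to the random arrival count.\<close>

lemma card_transactions_history_measurable:
  "(\<lambda>\<omega>. card (transactions S \<tau> \<omega>)) \<in> measurable (history S (slot_start S \<tau>)) (count_space UNIV)"
proof -
  let ?G = "history S (slot_start S \<tau>)" and ?A = "arrivals S (slot_start S \<tau>)"
  let ?E = "\<lambda>j. {\<omega> \<in> space (prob_meas S). j < ?A \<omega> \<and> buys S j \<omega>}"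
  note [measurable] = buys_adapted[OF slot_start_nonneg[of \<tau>]] arrivals_adapted[OF slot_start_nonneg[of \<tau>]]
  have [measurable]: "(\<lambda>\<omega>. \<Sum>j<n. if \<omega> \<in> ?E j then 1 else 0 :: nat) \<in> measurable ?G (count_space UNIV)" for n
    by measurable
  \<comment> \<open>The random upper limit is handled by splitting along its countably many
    values.\<close>
  have "(\<lambda>\<omega>. \<Sum>j<?A \<omega>. if \<omega> \<in> ?E j then 1 else 0 :: nat) \<in> measurable ?G (count_space UNIV)"
    by (rule measurable_compose_countable[where g = ?A and
          f = "\<lambda>n \<omega>. \<Sum>j<n. if \<omega> \<in> ?E j then 1 else 0 :: nat"]) measurable
  moreover have "(\<Sum>j<?A \<omega>. if \<omega> \<in> ?E j then 1 else 0 :: nat) = card (transactions S \<tau> \<omega>)"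
    if "\<omega> \<in> space ?G" for \<omega>
  proof -
    have "transactions S \<tau> \<omega> = {..<?A \<omega>} \<inter> {j. \<omega> \<in> ?E j}"
      using that by (auto simp: transactions_def space_history)
    moreover have "(\<Sum>j<?A \<omega>. if \<omega> \<in> ?E j then 1 else 0 :: nat) = card ({..<?A \<omega>} \<inter> {j. \<omega> \<in> ?E j})"
      by (subst sum.If_cases) auto
    ultimately show ?thesis by (simp only:)
  qed
  ultimately show ?thesis by (subst measurable_cong[symmetric]) auto
qed

section \<open>Sales of one slot and their law while the seller is average\<close>

text \<open>This is \<open>N(\<tau>)\<close> of the model, read off the list of decisions because
  \<open>decisions_iid\<close> gives the conditional law of that list.\<close>

definition sales :: "nat \<Rightarrow> 'a \<Rightarrow> nat" where
  "sales \<tau> \<omega> = length (filter id (decisions S \<tau> \<omega>))"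

lemma card_transactions_Suc:
  assumes "\<omega> \<in> space (prob_meas S)"
  shows "card (transactions S (Suc \<tau>) \<omega>) = card (transactions S \<tau> \<omega>) + sales \<tau> \<omega>"
proof -
  let ?a = "arrivals S (slot_start S \<tau>) \<omega>" and ?b = "arrivals S (slot_start S (Suc \<tau>)) \<omega>"
  let ?N = "{j \<in> {?a..<?b}. buys S j \<omega>}"
  have "?a \<le> ?b" using arrivals_mono[OF assms slot_start_nonneg slot_start_mono] by simp
  hence "transactions S (Suc \<tau>) \<omega> = transactions S \<tau> \<omega> \<union> ?N"
    by (auto simp: transactions_def)
  moreover have "transactions S \<tau> \<omega> \<inter> ?N = {}" by (auto simp: transactions_def)
  moreover have "sales \<tau> \<omega> = card ?N"
  proof -
    have "sales \<tau> \<omega> = length (filter (\<lambda>j. buys S j \<omega>) [?a..<?b])"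
      by (simp add: sales_def decisions_def filter_map comp_def)
    also have "\<dots> = card (set (filter (\<lambda>j. buys S j \<omega>) [?a..<?b]))"
      by (rule distinct_card[symmetric]) simp
    also have "set (filter (\<lambda>j. buys S j \<omega>) [?a..<?b]) = ?N" by auto
    finally show ?thesis .
  qed
  ultimately show ?thesis using finite_transactions[of \<tau> \<omega>] by (simp add: card_Un_disjoint)
qed

abbreviation slot_arrivals :: "nat \<Rightarrow> 'a \<Rightarrow> nat" where
  "slot_arrivals \<tau> \<omega> \<equiv> arrivals S (slot_start S (Suc \<tau>)) \<omega> - arrivals S (slot_start S \<tau>) \<omega>"

lemma sets_history_subset: "sets (history S t) \<subseteq> sets (prob_meas S)"
  using history_sub[of t] by (simp add: subalgebra_def)

text \<open>Serves twice: it makes \<open>sigma\<close> generate the intended sigma-algebra, and it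
  places that sigma-algebra inside the events of the model.\<close>

lemma history_and_arrivals_generator:
  "sets (history S (slot_start S \<tau>)) \<union>
     {{\<omega> \<in> space (prob_meas S). arrivals S t \<omega> = n} | t n.
        t \<in> {slot_start S \<tau> .. slot_start S (Suc \<tau>)}} \<subseteq> sets (prob_meas S)"
proof -
  have "{\<omega> \<in> space (prob_meas S). arrivals S t \<omega> = n} \<in> sets (prob_meas S)"
    if "t \<in> {slot_start S \<tau> .. slot_start S (Suc \<tau>)}" for t n
  proof -
    have "t \<ge> 0" using that slot_start_nonneg[of \<tau>] by simp
    note [measurable] = arrivals_adapted[OF this]
    have "{\<omega> \<in> space (history S t). arrivals S t \<omega> = n} \<in> sets (history S t)" by measurable
    thus ?thesis using sets_history_subset[of t] by (auto simp: space_history)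
  qed
  thus ?thesis using sets_history_subset by auto
qed

lemma space_history_and_arrivals [simp]:
  "space (history_and_arrivals S \<tau>) = space (prob_meas S)"
  by (simp add: history_and_arrivals_def space_measure_of_conv)

lemma sets_history_and_arrivals:
  "sets (history_and_arrivals S \<tau>) = sigma_sets (space (prob_meas S))
     (sets (history S (slot_start S \<tau>)) \<union>
      {{\<omega> \<in> space (prob_meas S). arrivals S t \<omega> = n} | t n.
         t \<in> {slot_start S \<tau> .. slot_start S (Suc \<tau>)}})"
  unfolding history_and_arrivals_def
  using history_and_arrivals_generator[of \<tau>] sets.space_closed[of "prob_meas S"]
  by (intro sets_measure_of) blast

lemma history_and_arrivals_subalgebra: "subalgebra (prob_meas S) (history_and_arrivals S \<tau>)"
  unfolding subalgebra_def sets_history_and_arrivals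
  using sets.sigma_sets_subset[OF history_and_arrivals_generator[of \<tau>]] by simp

lemma arrivals_history_and_arrivals_measurable:
  assumes "t \<in> {slot_start S \<tau> .. slot_start S (Suc \<tau>)}"
  shows "arrivals S t \<in> measurable (history_and_arrivals S \<tau>) (count_space UNIV)"
proof -
  have "arrivals S t -` {n} \<inter> space (history_and_arrivals S \<tau>) \<in> sets (history_and_arrivals S \<tau>)" for n
  proof -
    have "arrivals S t -` {n} \<inter> space (history_and_arrivals S \<tau>) =
        {\<omega> \<in> space (prob_meas S). arrivals S t \<omega> = n}" by auto
    also have "\<dots> \<in> sets (history_and_arrivals S \<tau>)"
      unfolding sets_history_and_arrivals using assms by (intro sigma_sets.Basic) blast
    finally show ?thesis .
  qed
  thus ?thesis by (intro measurable_count_space_eq2_countable[THEN iffD2]) auto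
qed

text \<open>On the past event \<open>H\<close> the seller is average, so arrival rate and purchase
  probability are constants. Splitting \<open>H\<close> by the number of arrivals makes the decision
  kernel constant too, and thinning sums the pieces.\<close>

lemma emeasure_average_slot_sales:
  assumes H: "H \<in> sets (history S (slot_start S \<tau>))"
    and avg: "\<And>\<omega>. \<omega> \<in> H \<Longrightarrow> card (transactions S \<tau> \<omega>) < rep_threshold S"
  shows "emeasure (prob_meas S) {\<omega>\<in>H. sales \<tau> \<omega> = m} =
    emeasure (prob_meas S) H * poisson_density (arrival_rate_avg S * P_ba S * delay S) m"
proof -
  let ?M = "prob_meas S" and ?G = "history_and_arrivals S \<tau>"
  let ?r = "arrival_rate_avg S * delay S" and ?p = "P_ba S"
  have p: "0 < ?p" "?p \<le> 1" and r: "0 < ?r"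
    using P_ba_pos purchase_prob_range delay_pos rates by (auto simp: P_ba_def)
  have HG: "H \<in> sets ?G"
    unfolding sets_history_and_arrivals using H by (intro sigma_sets.Basic) blast
  have H_space: "H \<subseteq> space ?M"
    using sets.sets_into_space[OF H] by (simp add: space_history)
  have rep: "reputation S \<tau> \<omega> < int (rep_threshold S)" if "\<omega> \<in> H" for \<omega>
    using avg[OF that] H_space that by (auto simp: reputation_eq_card)
  \<comment> \<open>Fixing the number of arrivals fixes the length in \<open>replicate_pmf\<close>.
    As \<open>H' n\<close> refers to the end of the slot, it is placed in
    \<open>history_and_arrivals\<close>, on which \<open>decisions_iid\<close> conditions.\<close>
  define H' where "H' n = {\<omega>\<in>H. slot_arrivals \<tau> \<omega> = n}" for n
  have H': "H' n \<in> sets ?G" for n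
  proof -
    note [measurable] = HG
    have [measurable]: "arrivals S (slot_start S \<tau>) \<in> measurable ?G (count_space UNIV)"
        "arrivals S (slot_start S (Suc \<tau>)) \<in> measurable ?G (count_space UNIV)"
      using slot_start_less[of \<tau>] by (auto intro!: arrivals_history_and_arrivals_measurable)
    have "H' n = {\<omega>\<in>space ?G. \<omega> \<in> H \<and> slot_arrivals \<tau> \<omega> = n}"
      using H_space by (auto simp: H'_def)
    also have "\<dots> \<in> sets ?G" by measurable
    finally show ?thesis .
  qed
  have arr: "emeasure ?M (H' n) = emeasure ?M H * pmf (poisson_pmf ?r) n" for n
  proof -
    have cond: "has_cond_pmf ?M (history S (slot_start S \<tau>)) (slot_arrivals \<tau>)
        (\<lambda>\<omega>. poisson_pmf (slot_arrival_rate S \<tau> \<omega> * (slot_start S (Suc \<tau>) - slot_start S \<tau>)))"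
      by (rule arrivals_poisson) (use slot_start_less in auto)
    have "slot_arrival_rate S \<tau> \<omega> * (slot_start S (Suc \<tau>) - slot_start S \<tau>) = ?r"
      if "\<omega> \<in> H" for \<omega>
      using rep[OF that] by (simp add: slot_arrival_rate_def slot_start_def algebra_simps)
    hence "emeasure ?M {\<omega>\<in>H. slot_arrivals \<tau> \<omega> \<in> {n}} =
        emeasure ?M H * emeasure (poisson_pmf ?r) {n}"
      by (intro has_cond_pmf_const_emeasure[OF finite_measure_axioms history_sub cond H]) auto
    thus ?thesis by (simp add: H'_def emeasure_pmf_single)
  qed
  have dec: "emeasure ?M {\<omega>\<in>H' n. sales \<tau> \<omega> = m} = emeasure ?M (H' n) * pmf (binomial_pmf n ?p) m" for n
  proof -
    have "slot_purchase_prob S \<tau> \<omega> = ?p" if "\<omega> \<in> H' n" for \<omega>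
      using rep[of \<omega>] that by (simp add: H'_def slot_purchase_prob_def reputable_def)
    \<comment> \<open>The preimage consists of the lists with \<open>m\<close> entries
      \<open>True\<close>, in the form in which \<open>binomial_pmf_altdef\<close> obtains the
      binomial law from coin flips.\<close>
    hence "emeasure ?M {\<omega>\<in>H' n. decisions S \<tau> \<omega> \<in> (length \<circ> filter id) -` {m}} =
        emeasure ?M (H' n) *
        emeasure (replicate_pmf n (bernoulli_pmf ?p)) ((length \<circ> filter id) -` {m})"
      by (intro has_cond_pmf_const_emeasure[OF finite_measure_axioms
            history_and_arrivals_subalgebra decisions_iid H']) (auto simp: H'_def)
    also have "emeasure (replicate_pmf n (bernoulli_pmf ?p)) ((length \<circ> filter id) -` {m}) =
        pmf (binomial_pmf n ?p) m"
      using p by (simp only: binomial_pmf_altdef[of ?p n] atLeastAtMost_iff less_imp_le pmf_map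
          measure_pmf.emeasure_eq_measure simp_thms)
    finally show ?thesis by (simp only: sales_def vimage_singleton_eq comp_def)
  qed
  have meas: "{\<omega>\<in>H' n. sales \<tau> \<omega> = m} \<in> sets ?M" for n
  proof -
    have "H' n \<in> sets ?M"
      using H' history_and_arrivals_subalgebra by (auto simp: subalgebra_def)
    note [measurable] = this has_cond_pmf_measurable[OF decisions_iid[of \<tau>]]
    have "{\<omega>\<in>H' n. sales \<tau> \<omega> = m} =
        {\<omega>\<in>space ?M. \<omega> \<in> H' n \<and> length (filter id (decisions S \<tau> \<omega>)) = m}"
      using H_space by (auto simp: H'_def sales_def)
    also have "\<dots> \<in> sets ?M" by measurable
    finally show ?thesis .
  qed
  have "emeasure ?M {\<omega>\<in>H. sales \<tau> \<omega> = m} = emeasure ?M (\<Union>n. {\<omega>\<in>H' n. sales \<tau> \<omega> = m})"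
    by (rule arg_cong[where f = "emeasure ?M"]) (auto simp: H'_def)
  also have "\<dots> = (\<integral>\<^sup>+n. emeasure ?M {\<omega>\<in>H' n. sales \<tau> \<omega> = m} \<partial>count_space UNIV)"
    using meas by (intro emeasure_UN_countable) (auto simp: disjoint_family_on_def H'_def)
  also have "\<dots> = emeasure ?M H * pmf (bind_pmf (poisson_pmf ?r) (\<lambda>n. binomial_pmf n ?p)) m"
    by (simp add: dec arr ennreal_pmf_bind nn_integral_measure_pmf mult.assoc nn_integral_cmult
        del: pmf_poisson pmf_binomial)
  also have "pmf (bind_pmf (poisson_pmf ?r) (\<lambda>n. binomial_pmf n ?p)) m =
      poisson_density (arrival_rate_avg S * P_ba S * delay S) m"
    using poisson_pmf_thinning[OF r p] pmf_poisson_density[of "?r * ?p"] r p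
    by (simp add: ac_simps)
  finally show ?thesis .
qed

section \<open>Law of the score below the threshold, and the drop out probability\<close>

lemma card_transactions_event:
  "{\<omega> \<in> space (prob_meas S). card (transactions S \<tau> \<omega>) = k} \<in> sets (history S (slot_start S \<tau>))"
  using measurable_sets[OF card_transactions_history_measurable, of "{k}" \<tau>]
  by (simp add: space_history vimage_def Collect_conj_eq Int_commute)

lemma card_transactions_event': "{\<omega> \<in> space (prob_meas S). card (transactions S \<tau> \<omega>) = k} \<in> events"
  using card_transactions_event sets_history_subset by blast

text \<open>The bound on \<open>k\<close> keeps the induction closed: the score before the last slot
  is some \<open>j \<le> k\<close>, hence below the threshold as well.\<close>

lemma prob_card_transactions:
  assumes "k < rep_threshold S"
  shows "prob {\<omega> \<in> space (prob_meas S). card (transactions S \<tau> \<omega>) = k} =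
    poisson_density (arrival_rate_avg S * P_ba S * (real \<tau> * delay S)) k"
  using assms
proof (induction \<tau> arbitrary: k)
  case 0
  have "{\<omega> \<in> space (prob_meas S). card (transactions S 0 \<omega>) = k} =
      (if k = 0 then space (prob_meas S) else {})"
    by (auto simp: transactions_def slot_start_def arrivals_0)
  \<comment> \<open>As \<open>0 ^ 0 = 1\<close>, the density with parameter 0 is the point mass at
    0.\<close>
  thus ?case by (simp add: poisson_density_def prob_space)
next
  case (Suc \<tau>)
  let ?c = "arrival_rate_avg S * P_ba S"
  define H where "H j = {\<omega> \<in> space (prob_meas S). card (transactions S \<tau> \<omega>) = j}" for j
  \<comment> \<open>The subtraction is truncated: for \<open>j > k\<close> this would be the event
    of score \<open>j\<close> and no sales, hence the premises \<open>j \<le> k\<close>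
    below.\<close>
  define E where "E j = {\<omega>\<in>H j. sales \<tau> \<omega> = k - j}" for j
  have H: "H j \<in> sets (history S (slot_start S \<tau>))" for j
    unfolding H_def by (rule card_transactions_event)
  have E_events: "E j \<in> events" if "j \<le> k" for j
  proof -
    \<comment> \<open>The scores before and after the slot determine its sales, so
      \<open>E j\<close> is an intersection of two score events already known to be
      measurable.\<close>
    have "E j = {\<omega> \<in> space (prob_meas S). card (transactions S \<tau> \<omega>) = j} \<inter>
        {\<omega> \<in> space (prob_meas S). card (transactions S (Suc \<tau>) \<omega>) = k}"
      using that by (auto simp: E_def H_def card_transactions_Suc)
    thus ?thesis using card_transactions_event' by auto
  qed
  have E: "prob (E j) = poisson_density (?c * (real \<tau> * delay S)) j * poisson_density (?c * delay S) (k - j)"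
    if "j \<le> k" for j
  proof -
    have "emeasure (prob_meas S) (E j) =
        emeasure (prob_meas S) (H j) * poisson_density (?c * delay S) (k - j)"
      unfolding E_def using that Suc.prems by (intro emeasure_average_slot_sales H) (auto simp: H_def)
    moreover have "poisson_density (?c * delay S) (k - j) \<ge> 0"
      using poisson_density_pos rates P_ba_pos delay_pos by (simp add: less_imp_le)
    ultimately have "prob (E j) = prob (H j) * poisson_density (?c * delay S) (k - j)"
      by (simp add: emeasure_eq_measure flip: ennreal_mult)
    thus ?thesis using Suc.IH[of j] Suc.prems that by (simp add: H_def)
  qed
  have "{\<omega> \<in> space (prob_meas S). card (transactions S (Suc \<tau>) \<omega>) = k} = (\<Union>j\<le>k. E j)"
    by (auto simp: E_def H_def card_transactions_Suc)
  also have "prob \<dots> = (\<Sum>j\<le>k. prob (E j))"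
    using E_events by (intro finite_measure_finite_Union) (auto simp: disjoint_family_on_def E_def H_def)
  also have "\<dots> = poisson_density (?c * (real \<tau> * delay S) + ?c * delay S) k"
    using E by (simp add: poisson_density_convolution)
  finally show ?case by (simp add: algebra_simps)
qed

text \<open>The right side depends on the seller only through \<lambda>1 \<open>P_ba\<close> and the
  threshold, so every monotonicity claim becomes one about the parameter or the number of terms of a
  Poisson distribution function.\<close>

lemma drop_out_prob_eq:
  assumes "T / delay S \<in> \<nat>"
  shows "drop_out_prob S T = (\<Sum>k<rep_threshold S. poisson_density (arrival_rate_avg S * P_ba S * T) k)"
proof -
  obtain n where "T / delay S = real n" using assms by (auto elim: Nats_cases)
  hence T: "T = real n * delay S" using delay_pos by (simp add: field_simps)
  have "{\<omega> \<in> space (prob_meas S). card (transactions S n \<omega>) < rep_threshold S} =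
      (\<Union>k<rep_threshold S. {\<omega> \<in> space (prob_meas S). card (transactions S n \<omega>) = k})" by auto
  also have "prob \<dots> =
      (\<Sum>k<rep_threshold S. prob {\<omega> \<in> space (prob_meas S). card (transactions S n \<omega>) = k})"
    using card_transactions_event'
    by (intro finite_measure_finite_Union) (auto simp: disjoint_family_on_def)
  also have "\<dots> = (\<Sum>k<rep_threshold S. poisson_density (arrival_rate_avg S * P_ba S * T) k)"
    by (simp add: T prob_card_transactions)
  finally show ?thesis using drop_out_prob_eq_reputation[of n] by (simp add: T)
qed

end

section \<open>The closed formula and the three monotonicity claims\<close>

theorem theorem4p2:
  fixes S :: "'a seller_model" and T\<^sub>w :: real
  assumes "honest_seller S" and "T\<^sub>w > 0" and "T\<^sub>w / delay S \<in> \<nat>"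
  shows "drop_out_prob S T\<^sub>w =
           (\<Sum>k = 0..rep_threshold S - 1.
              exp (- (arrival_rate_avg S * P_ba S * T\<^sub>w)) *
              ((arrival_rate_avg S * P_ba S * T\<^sub>w) ^ k / fact k))
       \<and> (\<forall>S' :: 'b seller_model. honest_seller S' \<longrightarrow>
            delay S' = delay S \<longrightarrow> rep_threshold S' = rep_threshold S \<longrightarrow>
            arrival_rate_avg S * P_ba S < arrival_rate_avg S' * P_ba S' \<longrightarrow>
            drop_out_prob S' T\<^sub>w < drop_out_prob S T\<^sub>w)
       \<and> (\<forall>T\<^sub>w'. T\<^sub>w' / delay S \<in> \<nat> \<longrightarrow> T\<^sub>w < T\<^sub>w' \<longrightarrow>
            drop_out_prob S T\<^sub>w' < drop_out_prob S T\<^sub>w)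
       \<and> (\<forall>S' :: 'b seller_model. honest_seller S' \<longrightarrow>
            delay S' = delay S \<longrightarrow>
            arrival_rate_avg S' * P_ba S' = arrival_rate_avg S * P_ba S \<longrightarrow>
            rep_threshold S < rep_threshold S' \<longrightarrow>
            drop_out_prob S T\<^sub>w < drop_out_prob S' T\<^sub>w)"
proof (intro conjI allI impI)
  interpret honest_seller S by fact
  let ?c = "arrival_rate_avg S * P_ba S"
  have c: "?c > 0" and r: "rep_threshold S > 0" using rates P_ba_pos rep_threshold_pos by auto
  note eq = drop_out_prob_eq[OF assms(3)]
  \<comment> \<open>Positivity of the threshold matters here, because
    \<open>rep_threshold S - 1\<close> is truncated at 0.\<close>
  have "{0..rep_threshold S - 1} = {..<rep_threshold S}" using r by auto
  thus "drop_out_prob S T\<^sub>w =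
      (\<Sum>k = 0..rep_threshold S - 1. exp (- (?c * T\<^sub>w)) * ((?c * T\<^sub>w) ^ k / fact k))"
    by (simp add: eq poisson_density_def)
  \<comment> \<open>Equal delays make \<open>T\<^sub>w\<close> a whole number of slots for
    \<open>S'\<close> as well, so the formula applies to both sellers.\<close>
  show "drop_out_prob S' T\<^sub>w < drop_out_prob S T\<^sub>w"
    if "honest_seller S'" "delay S' = delay S" "rep_threshold S' = rep_threshold S"
      "?c < arrival_rate_avg S' * P_ba S'" for S' :: "'b seller_model"
    using honest_seller.drop_out_prob_eq[OF that(1), of T\<^sub>w] that assms c r
    by (auto simp: eq intro!: poisson_cdf_strict_decreasing)
  show "drop_out_prob S T\<^sub>w' < drop_out_prob S T\<^sub>w" if "T\<^sub>w' / delay S \<in> \<nat>" "T\<^sub>w < T\<^sub>w'" for T\<^sub>w'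
    unfolding eq drop_out_prob_eq[OF that(1)]
    by (rule poisson_cdf_strict_decreasing[OF r])
      (use c assms(2) that(2) in \<open>auto intro: mult_strict_left_mono\<close>)
  \<comment> \<open>The parameter is positive, so all terms are; the index
    \<open>rep_threshold S\<close> witnesses that the sum for \<open>S'\<close> has an extra
    one.\<close>
  show "drop_out_prob S T\<^sub>w < drop_out_prob S' T\<^sub>w"
    if "honest_seller S'" "delay S' = delay S" "arrival_rate_avg S' * P_ba S' = ?c"
      "rep_threshold S < rep_threshold S'" for S' :: "'b seller_model"
    using honest_seller.drop_out_prob_eq[OF that(1), of T\<^sub>w] that assms c
    by (auto simp: eq poisson_density_pos less_imp_le
        intro!: sum_strict_mono2[of _ _ "rep_threshold S"])
qed

end
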